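(* Let $A\in\mathbb{R}^{d\times d}$, let $B\in\mathbb{R}^{d\times d}$ be symmetric positive definite, and let $(v^k)_{k\in\mathbb{N}}$ be the random sequence generated by the one-sample zeroth-order method (Algorithm 1, described in the context). Assume $\dim(G_{\max})<d-1$. Then, almost surely, $$ r(A,B,v^k)\to \mathcal{R}(A,B)\quad\text{and}\quad \operatorname{dist}(G_{\max},v^k)\to 0 \qquad\text{as } k\to\infty. $$
   Context: $\langle\cdot,\cdot\rangle$ and $\|\cdot\|$ are the Euclidean inner product and norm. Put $A^{\mathrm H}=\tfrac12(A+A^{\mathrm T})$, $\langle v,w\rangle_B=\langle v,Bw\rangle$, $\|v\|_B=\sqrt{\langle v,Bv\rangle}$, $\mathbb{S}_B^{d-1}=\{v\in\mathbb{R}^d:\|v\|_B=1\}$. For $v\in\mathbb{S}_B^{d-1}$ let $T_v=\{x\in\mathbb{R}^d:\langle x,Bv\rangle=0\}$ and let $P_v y=y-\frac{\langle y,Bv\rangle}{\|Bv\|^2}Bv$ be the Euclidean orthogonal projection onto $T_v$. The generalized Rayleigh quotient is $r(A,B,v)=\frac{\langle v,Av\rangle}{\langle v,Bv\rangle}$ for $v\ne0$, and $\mathcal{R}(A,B)=\max_{v\neq 0} r(A,B,v)$. A number $\lambda\in\mathbb{R}$ is a generalized eigenvalue of $(A^{\mathrm H},B)$ if $A^{\mathrm H}v=\lambda Bv$ for some $v\ne0$; $G_\lambda=\{v\in\mathbb{R}^d\setminus\{0\}:A^{\mathrm H}v=\lambda Bv\}$, and $\dim(G_\lambda)$ denotes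 the dimension of the linear subspace $G_\lambda\cup\{0\}$. $\mathcal{R}(A,B)$ is the largest generalized eigenvalue and $G_{\max}=G_{\mathcal{R}(A,B)}$. Further, $\operatorname{dist}(S,x)=\inf_{y\in S}\|x-y\|$. Algorithm 1: Initialize $v^0=\tilde v/\|\tilde v\|_B$ with $\tilde v\sim\mathcal{N}(0,I_d)$. For $k=0,1,2,\dots$: sample $\tilde x\sim\mathcal{N}(0,I_d)$ independently of everything before and set $x^k=P_{v^k}\tilde x/\|P_{v^k}\tilde x\|$; if $\langle x^k,A^{\mathrm H}v^k\rangle=0$, stop; otherwise let $\tau_k=\operatorname{argmax}_{\tau\in\mathbb{R}} r(A,B,v^k+\tau x^k)$ (the maximizer exists and is unique in this case) and set $v^{k+1}=\frac{v^k+\tau_kx^k}{\|v^k+\tau_kx^k\|_B}$. Under $\dim(G_{\max})<d-1$ the algorithm almost surely never stops, so the sequence is infinite a.s. *)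

theory Defs
  imports "HOL-Probability.Probability"
begin

definition symm_part :: "real^'n^'n \<Rightarrow> real^'n^'n" where
  "symm_part A = (1/2) *\<^sub>R (A + transpose A)"

definition normB :: "real^'n^'n \<Rightarrow> real^'n \<Rightarrow> real" where
  "normB B v = sqrt (v \<bullet> (B *v v))"

definition projT :: "real^'n^'n \<Rightarrow> real^'n \<Rightarrow> real^'n \<Rightarrow> real^'n" where
  "projT B v y = y - ((y \<bullet> (B *v v)) / (norm (B *v v))\<^sup>2) *\<^sub>R (B *v v)"

definition rayleigh :: "real^'n^'n \<Rightarrow> real^'n^'n \<Rightarrow> real^'n \<Rightarrow> real" where
  "rayleigh A B v = (v \<bullet> (A *v v)) / (v \<bullet> (B *v v))"

text \<open>The maximum (not merely the supremum) of the generalized Rayleigh quotient; it is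
  attained whenever \<open>B\<close> is symmetric positive definite.\<close>

definition rayleigh_max :: "real^'n^'n \<Rightarrow> real^'n^'n \<Rightarrow> real" where
  "rayleigh_max A B = (GREATEST \<rho>. \<exists>v. v \<noteq> 0 \<and> \<rho> = rayleigh A B v)"

definition gen_eigvecs :: "real^'n^'n \<Rightarrow> real^'n^'n \<Rightarrow> real \<Rightarrow> (real^'n) set" where
  "gen_eigvecs A B l = {v. v \<noteq> 0 \<and> symm_part A *v v = l *\<^sub>R (B *v v)}"

definition G_max :: "real^'n^'n \<Rightarrow> real^'n^'n \<Rightarrow> (real^'n) set" where
  "G_max A B = gen_eigvecs A B (rayleigh_max A B)"

text \<open>Lebesgue density of the standard normal distribution \<open>N(0, I)\<close>.\<close>

definition std_gaussian_density :: "real^'n \<Rightarrow> real" where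
  "std_gaussian_density x = exp (- (norm x)\<^sup>2 / 2) / sqrt (2 * pi) ^ CARD('n)"

definition search_dir :: "real^'n^'n \<Rightarrow> real^'n \<Rightarrow> real^'n \<Rightarrow> real^'n" where
  "search_dir B v xt = projT B v xt /\<^sub>R norm (projT B v xt)"

definition step_size :: "real^'n^'n \<Rightarrow> real^'n^'n \<Rightarrow> real^'n \<Rightarrow> real^'n \<Rightarrow> real" where
  "step_size A B v x = arg_max (\<lambda>\<tau>. rayleigh A B (v + \<tau> *\<^sub>R x)) (\<lambda>_. True)"

text \<open>The iterates as a function of the samples: \<open>vt\<close> is the sample used for the
  initialization and \<open>xt k\<close> the one drawn in step \<open>k\<close>. The value \<open>None\<close> at index \<open>k\<close> means
  that the algorithm has stopped before producing the \<open>k\<close>-th iterate.\<close>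

primrec zo_iterate ::
  "real^'n^'n \<Rightarrow> real^'n^'n \<Rightarrow> real^'n \<Rightarrow> (nat \<Rightarrow> real^'n) \<Rightarrow> nat \<Rightarrow> (real^'n) option"
where
  "zo_iterate A B vt xt 0 = Some (vt /\<^sub>R normB B vt)"
| "zo_iterate A B vt xt (Suc k) =
    (case zo_iterate A B vt xt k of
       None \<Rightarrow> None
     | Some v \<Rightarrow>
         (let x = search_dir B v (xt k); w = v + step_size A B v x *\<^sub>R x
          in if x \<bullet> (symm_part A *v v) = 0 then None else Some (w /\<^sub>R normB B w)))"

end

theory Submission
  imports Defs
begin

text \<open>Let \<open>g \<in> G_max\<close>. At a state \<open>v\<close> with \<open>\<parallel>v\<parallel>\<^sub>B = 1\<close> the point \<open>z = g - \<langle>g, Bv\<rangle> v\<close> lies in \<open>T\<^sub>v\<close>, and a sample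
  close to \<open>z\<close> gives a search direction for which the plane spanned by it and \<open>v\<close> contains a point
  close to \<open>g\<close>. Since \<open>z\<close> stays bounded, for every \<open>c < \<rho>\<close> a single step reaches \<open>r > c\<close> with a
  probability bounded below uniformly in \<open>v\<close>. The samples are independent and \<open>r\<close> increases along
  the iteration, so \<open>r(v\<^sup>k) \<rightarrow> \<rho>\<close> almost surely; saddle points need no separate treatment.

  The method stops only at a generalized eigenvector or on a null set of samples. A step from a
  non-eigenvector \<open>v\<close> can lead to an eigenvector only if its eigenvalue \<open>l\<close> exceeds \<open>r(v)\<close> and the
  projected sample lies in the span of \<open>v\<close> and the eigenspace of \<open>l\<close>; under the dimension
  assumption this is a proper subspace, so almost surely it does not happen.\<close>

section \<open>Maximizing the Rayleigh quotient on a line\<close>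

text \<open>The root with the sign of \<open>b\<close> of \<open>q * b * t\<^sup>2 - (c - q * a) * t - b = 0\<close>, the critical
  point equation of \<open>(a + 2 * b * t + c * t\<^sup>2) / (1 + q * t\<^sup>2)\<close>. A closed form makes the choice
  made by \<open>arg_max\<close> measurable in the data.\<close>

definition line_max :: "real \<Rightarrow> real \<Rightarrow> real \<Rightarrow> real \<Rightarrow> real" where
  "line_max a b c q = ((c - q * a) + sqrt ((c - q * a)\<^sup>2 + 4 * q * b\<^sup>2)) / (2 * q * b)"

text \<open>The discriminant exceeds \<open>(c - q * a)\<^sup>2\<close>, so \<open>t\<close> has the
  sign of \<open>b\<close>. The second claim is the critical point equation with
  \<open>a + b * t\<close> as the value at \<open>t\<close>.\<close>

lemma line_max_stationary:
  fixes a b c q :: real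
  assumes "q > 0" "b \<noteq> 0"
  defines "t \<equiv> line_max a b c q"
  shows "b * t > 0" "b + c * t = (a + b * t) * q * t"
proof -
  define D where "D = (c - q * a)\<^sup>2 + 4 * q * b\<^sup>2"
  have D: "D > (c - q * a)\<^sup>2" "D \<ge> 0"
    using assms by (auto simp: D_def)
  then have s: "sqrt D > \<bar>c - q * a\<bar>"
    by (metis real_sqrt_abs real_sqrt_less_mono)
  have t: "2 * q * b * t = (c - q * a) + sqrt D"
    using assms(1,2) by (simp add: t_def line_max_def D_def)
  have "2 * q * (b * t) > 0"
    using s t by (simp add: mult.assoc)
  then show "b * t > 0"
    using assms(1) by (simp add: zero_less_mult_iff)
  have "(2 * q * b * t - (c - q * a))\<^sup>2 = D"
    using t D by simp
  then have "4 * q * b * (q * b * t\<^sup>2 - (c - q * a) * t - b) = 0"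
    unfolding D_def by (simp add: power2_eq_square algebra_simps)
  then have "q * b * t\<^sup>2 - (c - q * a) * t - b = 0"
    using assms(1,2) by simp
  then show "b + c * t = (a + b * t) * q * t"
    by (simp add: power2_eq_square algebra_simps)
qed

text \<open>The gap between \<open>f t\<close> and \<open>f s\<close>, times the denominator at
  \<open>s\<close>, is \<open>(b / t) * (s - t)\<^sup>2\<close>. Since \<open>b / t > 0\<close>,
  this gives strict global maximality at once.\<close>

lemma line_max_unique:
  fixes a b c q :: real
  assumes "q > 0" "b \<noteq> 0"
  defines "t \<equiv> line_max a b c q"
  defines "f \<equiv> \<lambda>s. (a + 2 * b * s + c * s\<^sup>2) / (1 + q * s\<^sup>2)"
  shows "f t = a + b * t" "s \<noteq> t \<Longrightarrow> f s < f t"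
proof -
  note st = line_max_stationary[OF assms(1,2), where a = a and c = c, folded t_def]
  have tn: "t \<noteq> 0" using st(1) by auto
  have pos: "1 + q * s\<^sup>2 > 0" for s
    using assms(1) by (simp add: add_pos_nonneg)
  have key: "(a + b * t) * (1 + q * s\<^sup>2) - (a + 2 * b * s + c * s\<^sup>2) = (b / t) * (s - t)\<^sup>2" for s
  proof -
    have "t * ((a + b * t) * q - c) = b"
      using st(2) by (simp add: algebra_simps)
    then have "(a + b * t) * q - c = b / t"
      using tn by (simp add: field_simps)
    then have "(a + b * t) * q = b / t + c" by simp
    then have "(a + b * t) * (1 + q * s\<^sup>2) = a + b * t + (b / t + c) * s\<^sup>2"
      by (metis distrib_left mult.assoc mult.right_neutral)
    then show ?thesis
      using tn by (simp add: field_simps power2_eq_square)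
  qed
  have bt: "b / t > 0"
    using st(1) by (metis zero_less_divide_iff zero_less_mult_iff)
  show ft: "f t = a + b * t"
    using key[of t] pos[of t] by (simp add: f_def field_simps)
  show "f s < f t" if "s \<noteq> t"
  proof -
    have "(b / t) * (s - t)\<^sup>2 > 0"
      using bt that by (intro mult_pos_pos) auto
    then have "a + 2 * b * s + c * s\<^sup>2 < (a + b * t) * (1 + q * s\<^sup>2)"
      using key[of s] by linarith
    then have "f s < a + b * t"
      unfolding f_def using pos[of s] by (simp add: pos_divide_less_eq)
    then show ?thesis using ft by simp
  qed
qed

text \<open>The arguments are the coefficients of the quotient along \<open>v + t x\<close> for a
  B-normalized \<open>v\<close> and a direction \<open>x\<close> that is B-orthogonal to it.\<close>

definition step_formula :: "real^'n^'n \<Rightarrow> real^'n^'n \<Rightarrow> real^'n \<Rightarrow> real^'n \<Rightarrow> real" where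
  "step_formula A B v x =
    line_max (v \<bullet> (A *v v)) (x \<bullet> (symm_part A *v v)) (x \<bullet> (A *v x)) (x \<bullet> (B *v x))"

text \<open>A total version of the iteration, without the stopping test, so that measurability and
  independence can be treated without \<open>option\<close> values.\<close>

definition zo_step :: "real^'n^'n \<Rightarrow> real^'n^'n \<Rightarrow> real^'n \<Rightarrow> real^'n \<Rightarrow> real^'n" where
  "zo_step A B v y =
    (let x = search_dir B v y; w = v + step_formula A B v x *\<^sub>R x in w /\<^sub>R normB B w)"

text \<open>At such a state the algorithm almost surely does not stop.\<close>

definition regular_state :: "real^'n^'n \<Rightarrow> real^'n^'n \<Rightarrow> real^'n \<Rightarrow> bool" where
  "regular_state A B v \<longleftrightarrow> v \<bullet> (B *v v) = 1 \<and> (\<forall>l. symm_part A *v v \<noteq> l *\<^sub>R (B *v v))"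

lemma inner_symm_matrix:
  fixes C :: "real^'n^'n"
  assumes "transpose C = C"
  shows "x \<bullet> (C *v y) = y \<bullet> (C *v x)"
  using assms dot_lmul_matrix[of x C y] transpose_matrix_vector[of C x]
  by (simp add: inner_commute)

lemma transpose_symm_part: "transpose (symm_part A) = symm_part A"
  by (simp add: symm_part_def transpose_def vec_eq_iff)

lemma inner_symm_part: "x \<bullet> (symm_part A *v x) = x \<bullet> (A *v x)"
proof -
  have "x \<bullet> (transpose A *v x) = x \<bullet> (A *v x)"
    using dot_lmul_matrix[of x A x] transpose_matrix_vector[of A x] by (simp add: inner_commute)
  then show ?thesis
    by (simp add: symm_part_def matrix_vector_mult_add_rdistrib scaleR_matrix_vector_assoc[symmetric]
        inner_right_distrib)
qed

section \<open>Symmetric-definite pencils\<close>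

locale spd_pencil =
  fixes A B :: "real^'n^'n"
  assumes B_sym: "transpose B = B"
    and B_pos: "\<And>x. x \<noteq> 0 \<Longrightarrow> 0 < x \<bullet> (B *v x)"
begin

abbreviation "r \<equiv> rayleigh A B"
abbreviation "S \<equiv> symm_part A"
abbreviation "\<rho> \<equiv> rayleigh_max A B"

lemmas S_comm = inner_symm_matrix[OF transpose_symm_part[of A]]
lemmas B_comm = inner_symm_matrix[OF B_sym]

lemma B_eq_0: "x \<bullet> (B *v x) = 0 \<longleftrightarrow> x = 0"
  using B_pos[of x] by (cases "x = 0") auto

lemma B_mult_eq_0: "B *v x = 0 \<longleftrightarrow> x = 0"
  using B_eq_0[of x] by auto

lemma rayleigh_symm: "r v = (v \<bullet> (S *v v)) / (v \<bullet> (B *v v))"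
  by (simp add: rayleigh_def inner_symm_part)

lemma rayleigh_scale: "c \<noteq> 0 \<Longrightarrow> r (c *\<^sub>R v) = r v"
  by (simp add: rayleigh_def matrix_vector_mult_scaleR)

lemma normB_normalized:
  assumes "w \<noteq> 0"
  shows "(w /\<^sub>R normB B w) \<bullet> (B *v (w /\<^sub>R normB B w)) = 1"
  using B_pos[OF assms] by (simp add: normB_def matrix_vector_mult_scaleR field_simps)

lemma normB_pos: "w \<noteq> 0 \<Longrightarrow> normB B w > 0"
  using B_pos by (simp add: normB_def)

lemma continuous_rayleigh: "continuous_on (- {0}) r"
  unfolding rayleigh_def
  by (intro continuous_intros matrix_vector_mult_linear_continuous_on) (auto simp: B_eq_0)

text \<open>By homogeneity all values are taken on the compact unit sphere, where a maximum is
  attained.\<close>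

lemma rayleigh_max_attained:
  obtains g where "g \<noteq> 0" "r g = \<rho>" "\<And>v. v \<noteq> 0 \<Longrightarrow> r v \<le> \<rho>"
proof -
  have "continuous_on (sphere 0 1) r"
    by (rule continuous_on_subset[OF continuous_rayleigh]) auto
  moreover have "sphere (0::real^'n) 1 \<noteq> {}" "compact (sphere (0::real^'n) 1)" by auto
  ultimately obtain g where g: "g \<in> sphere 0 1" "\<And>v. v \<in> sphere 0 1 \<Longrightarrow> r v \<le> r g"
    using continuous_attains_sup[of "sphere 0 1" r] by blast
  have le: "r v \<le> r g" if "v \<noteq> 0" for v
    using g(2)[of "v /\<^sub>R norm v"] rayleigh_scale[of "inverse (norm v)" v] that by simp
  have "\<rho> = r g"
    unfolding rayleigh_max_def
  proof (rule Greatest_equality)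
    show "\<exists>v. v \<noteq> 0 \<and> r g = r v"
      using g(1) by (intro exI[of _ g]) auto
  qed (use le in auto)
  then moreover have "g \<noteq> 0" using g(1) by auto
  ultimately show ?thesis using that[of g] le by auto
qed

lemma rayleigh_le_max: "v \<noteq> 0 \<Longrightarrow> r v \<le> \<rho>"
  by (rule rayleigh_max_attained) blast

lemma gen_eigvecs_rayleigh: "v \<in> gen_eigvecs A B l \<Longrightarrow> r v = l"
  using B_pos[of v] by (auto simp: gen_eigvecs_def rayleigh_symm)

text \<open>The form \<open>x \<bullet> m x\<close> is nonpositive and vanishes at \<open>g\<close>,
  so its first variation at \<open>g\<close> vanishes. Testing in the direction
  \<open>h = m g\<close> gives \<open>m g = 0\<close>.\<close>

lemma maximizer_in_G_max:
  assumes "g \<noteq> 0" "r g = \<rho>"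
  shows "g \<in> G_max A B"
proof -
  define m where "m = (\<lambda>x. S *v x - \<rho> *\<^sub>R (B *v x))"
  have m_lin: "m (x + t *\<^sub>R y) = m x + t *\<^sub>R m y" for x y t
    by (simp add: m_def algebra_simps matrix_vector_mult_scaleR)
  have m_sym: "x \<bullet> m y = y \<bullet> m x" for x y
    using S_comm[of x y] B_comm[of x y] by (simp add: m_def inner_diff_right)
  have m_le: "x \<bullet> m x \<le> 0" for x
  proof (cases "x = 0")
    case False
    then show ?thesis
      using rayleigh_le_max[OF False] B_pos[OF False]
      by (simp add: rayleigh_symm m_def inner_diff_right field_simps)
  qed simp
  have g0: "g \<bullet> m g = 0"
    using assms B_pos[OF assms(1)] by (simp add: rayleigh_symm m_def inner_diff_right field_simps)
  define h where "h = m g"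
  define n where "n = h \<bullet> h"
  define c where "c = h \<bullet> m h"
  have q: "2 * t * n + t\<^sup>2 * c \<le> 0" for t
    using m_le[of "g + t *\<^sub>R h"] g0 m_sym[of g "m g"]
    by (simp add: m_lin inner_add_left inner_add_right n_def c_def h_def power2_eq_square
        algebra_simps)
  have "n = 0"
  proof (rule ccontr)
    assume "n \<noteq> 0"
    then have n: "n > 0" by (simp add: n_def)
    \<comment> \<open>Chosen so that \<open>t * \<bar>c\<bar> \<le> n\<close>; the second-order term
      then cannot outweigh the first-order term \<open>2 * n\<close>.\<close>
    define t where "t = n / (\<bar>c\<bar> + 1)"
    have t: "t > 0" "t * \<bar>c\<bar> \<le> n"
      using n by (auto simp: t_def field_simps)
    have "t * (2 * n + t * c) \<le> 0" using q[of t] by (simp add: power2_eq_square algebra_simps)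
    then have "2 * n + t * c \<le> 0" using t(1) by (simp add: mult_le_0_iff)
    moreover have "t * (- \<bar>c\<bar>) \<le> t * c"
      using t(1) by (intro mult_left_mono) auto
    ultimately show False using t(2) n by linarith
  qed
  then show ?thesis
    using assms(1) by (simp add: n_def h_def m_def G_max_def gen_eigvecs_def)
qed

lemma G_max_nonempty: obtains g where "g \<in> G_max A B" "g \<noteq> 0" "r g = \<rho>"
  by (rule rayleigh_max_attained) (use maximizer_in_G_max that in blast)

definition eigenspace :: "real \<Rightarrow> (real^'n) set" where
  "eigenspace l = {v. S *v v = l *\<^sub>R (B *v v)}"

lemma subspace_eigenspace: "subspace (eigenspace l)"
  by (auto simp: subspace_def eigenspace_def algebra_simps matrix_vector_mult_scaleR)

lemma eigenspace_max: "G_max A B \<union> {0} = eigenspace \<rho>"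
  by (auto simp: G_max_def gen_eigvecs_def eigenspace_def)

lemma rayleigh_eigenspace: "v \<in> eigenspace l \<Longrightarrow> v \<noteq> 0 \<Longrightarrow> r v = l"
  using gen_eigvecs_rayleigh[of v l] by (auto simp: eigenspace_def gen_eigvecs_def)

definition eigenvalues :: "real set" where
  "eigenvalues = {l. \<exists>v\<in>eigenspace l. v \<noteq> 0}"

text \<open>Eigenvectors to different eigenvalues are B-orthogonal, hence independent. Finiteness
  later keeps the exceptional samples in a finite union of null sets.\<close>

lemma finite_eigenvalues: "finite eigenvalues"
proof -
  have "\<forall>l\<in>eigenvalues. \<exists>v. v \<in> eigenspace l \<and> v \<noteq> 0"
    by (auto simp: eigenvalues_def)
  from bchoice[OF this]
  obtain e where "\<forall>l\<in>eigenvalues. e l \<in> eigenspace l \<and> e l \<noteq> 0" ..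
  then have e: "e l \<in> eigenspace l \<and> e l \<noteq> 0" if "l \<in> eigenvalues" for l
    using that by blast
  have inj: "inj_on e eigenvalues"
    using e rayleigh_eigenspace by (metis inj_onI)
  have orth: "e l \<bullet> (B *v e k) = 0" if "l \<in> eigenvalues" "k \<in> eigenvalues" "l \<noteq> k" for l k
  proof -
    have "e l \<bullet> (S *v e k) = k * (e l \<bullet> (B *v e k))" "e k \<bullet> (S *v e l) = l * (e k \<bullet> (B *v e l))"
      using e that by (auto simp: eigenspace_def)
    then have "(l - k) * (e l \<bullet> (B *v e k)) = 0"
      using S_comm[of "e l" "e k"] B_comm[of "e l" "e k"] by (simp add: algebra_simps)
    then show ?thesis using that by simp
  qed
  have "independent (e ` eigenvalues)"
    unfolding dependent_explicit
  proof (rule notI, elim exE conjE bexE)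
    fix t u v
    assume t: "finite t" "t \<subseteq> e ` eigenvalues" "(\<Sum>v\<in>t. u v *\<^sub>R v) = 0" and v: "v \<in> t" "u v \<noteq> 0"
    have "0 = (\<Sum>w\<in>t. u w *\<^sub>R w) \<bullet> (B *v v)" using t by simp
    also have "\<dots> = (\<Sum>w\<in>t. u w * (w \<bullet> (B *v v)))"
      by (simp add: inner_sum_left)
    also have "\<dots> = u v * (v \<bullet> (B *v v)) + (\<Sum>w\<in>t - {v}. u w * (w \<bullet> (B *v v)))"
      using t(1) v(1) by (rule sum.remove)
    also have "(\<Sum>w\<in>t - {v}. u w * (w \<bullet> (B *v v))) = 0"
    proof (rule sum.neutral, rule ballI)
      fix w assume "w \<in> t - {v}"
      then have "w \<in> e ` eigenvalues" "v \<in> e ` eigenvalues" "w \<noteq> v"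
        using t(2) v(1) by auto
      then show "u w * (w \<bullet> (B *v v)) = 0" using orth by auto
    qed
    finally have "v \<bullet> (B *v v) = 0" using v(2) by simp
    then have "v = 0" by (simp add: B_eq_0)
    moreover have "v \<noteq> 0" using t(2) v(1) e by auto
    ultimately show False by simp
  qed
  then have "finite (e ` eigenvalues)" using independent_bound by blast
  then show ?thesis by (rule finite_imageD[OF _ inj])
qed

section \<open>Projection onto the tangent space and search directions\<close>

lemma projT_orth:
  "v \<noteq> 0 \<Longrightarrow> projT B v y \<bullet> (B *v v) = 0"
  using B_mult_eq_0[of v] by (simp add: projT_def inner_diff_left power2_norm_eq_inner)

lemma linear_projT: "linear (projT B v)"
  by (rule linearI) (simp_all add: projT_def inner_add_left add_divide_distrib algebra_simps)

lemma projT_fixes: "y \<bullet> (B *v v) = 0 \<Longrightarrow> projT B v y = y"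
  by (simp add: projT_def)

lemma projT_self_adjoint: "projT B v x \<bullet> y = x \<bullet> projT B v y"
  by (simp add: projT_def inner_diff_left inner_diff_right inner_commute)

lemma projT_norm_le:
  assumes "v \<noteq> 0"
  shows "norm (projT B v y) \<le> norm y"
proof -
  have "projT B v y \<bullet> projT B v y = y \<bullet> projT B v y"
    using projT_fixes[OF projT_orth[OF assms]] by (simp add: projT_self_adjoint)
  then have "(norm (projT B v y))\<^sup>2 \<le> norm y * norm (projT B v y)"
    using norm_cauchy_schwarz[of y "projT B v y"] by (simp add: power2_norm_eq_inner)
  then show ?thesis
    by (cases "norm (projT B v y) = 0") (auto simp: power2_eq_square mult_le_cancel_right)
qed

text \<open>If the projected sample vanishes, \<open>search_dir\<close> is zero by the convention
  for \<open>inverse 0\<close>, and so is its inner product with \<open>S *v v\<close>. The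
  condition for not stopping thus also excludes this degenerate case.\<close>

lemma search_dir_props:
  assumes "v \<noteq> 0" and b: "search_dir B v y \<bullet> (S *v v) \<noteq> 0"
  shows "search_dir B v y \<noteq> 0" "search_dir B v y \<bullet> (B *v v) = 0"
    "projT B v y \<noteq> 0" "projT B v y = norm (projT B v y) *\<^sub>R search_dir B v y"
proof -
  show "search_dir B v y \<noteq> 0" using b by auto
  then show "projT B v y \<noteq> 0" by (auto simp: search_dir_def)
  then show "projT B v y = norm (projT B v y) *\<^sub>R search_dir B v y"
    by (simp add: search_dir_def)
  show "search_dir B v y \<bullet> (B *v v) = 0"
    using projT_orth[OF assms(1), of y] by (simp add: search_dir_def)
qed

lemma regular_stateD:
  "regular_state A B v \<Longrightarrow> v \<bullet> (B *v v) = 1" "regular_state A B v \<Longrightarrow> v \<noteq> 0"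
  by (auto simp: regular_state_def)

lemma regular_state_projT: "regular_state A B v \<Longrightarrow> projT B v (S *v v) \<noteq> 0"
  by (auto simp: regular_state_def projT_def)

section \<open>Exact line search along a tangent direction\<close>

context
  fixes v x :: "real^'n"
  assumes v: "v \<bullet> (B *v v) = 1" and x: "x \<bullet> (B *v v) = 0" and b: "x \<bullet> (S *v v) \<noteq> 0"
begin

lemma rayleigh_line:
  "r (v + t *\<^sub>R x) = (v \<bullet> (A *v v) + 2 * (x \<bullet> (S *v v)) * t + x \<bullet> (A *v x) * t\<^sup>2)
    / (1 + x \<bullet> (B *v x) * t\<^sup>2)"
proof -
  have "(v + t *\<^sub>R x) \<bullet> (S *v (v + t *\<^sub>R x)) =
      v \<bullet> (S *v v) + 2 * (x \<bullet> (S *v v)) * t + x \<bullet> (S *v x) * t\<^sup>2"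
    using S_comm[of v x]
    by (simp add: matrix_vector_mult_scaleR matrix_vector_right_distrib inner_add_left
        inner_add_right power2_eq_square distrib_left mult_ac)
  moreover have "(v + t *\<^sub>R x) \<bullet> (B *v (v + t *\<^sub>R x)) = 1 + x \<bullet> (B *v x) * t\<^sup>2"
    using v x B_comm[of v x]
    by (simp add: matrix_vector_mult_scaleR matrix_vector_right_distrib inner_add_left
        inner_add_right power2_eq_square)
  ultimately show ?thesis by (simp add: rayleigh_symm inner_symm_part)
qed

lemma line_q_pos: "x \<bullet> (B *v x) > 0"
  using b B_pos[of x] by (cases "x = 0") auto

lemmas line_unique = line_max_unique[OF line_q_pos b, where a = "v \<bullet> (A *v v)" and c = "x \<bullet> (A *v x)",
    folded rayleigh_line step_formula_def]
lemmas line_stationary = line_max_stationary[OF line_q_pos b, where a = "v \<bullet> (A *v v)" and c = "x \<bullet> (A *v x)",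
    folded step_formula_def]

text \<open>\<open>arg_max\<close> is a choice operator; strict maximality of the closed form leaves
  it only one value.\<close>

lemma step_size_eq: "step_size A B v x = step_formula A B v x"
  unfolding step_size_def arg_max_def
proof (rule some_equality)
  show "is_arg_max (\<lambda>\<tau>. r (v + \<tau> *\<^sub>R x)) (\<lambda>_. True) (step_formula A B v x)"
    unfolding is_arg_max_def using line_unique(2) by (metis less_asym)
  show "t = step_formula A B v x" if "is_arg_max (\<lambda>\<tau>. r (v + \<tau> *\<^sub>R x)) (\<lambda>_. True) t" for t
    using line_unique(2)[of t] that by (auto simp: is_arg_max_def)
qed

lemma line_max_le: "r (v + t *\<^sub>R x) \<le> r (v + step_formula A B v x *\<^sub>R x)"
  using line_unique(2)[of t] by fastforce

lemma line_increase: "r v < r (v + step_formula A B v x *\<^sub>R x)"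
  using line_unique(1) line_stationary(1) v by (simp add: rayleigh_def)

lemma line_nonzero: "v + t *\<^sub>R x \<noteq> 0"
proof
  assume "v + t *\<^sub>R x = 0"
  then have "(v + t *\<^sub>R x) \<bullet> (B *v v) = 0" by simp
  then show False using v x by (simp add: inner_add_left)
qed

end

end

section \<open>A single step of the method\<close>

text \<open>The preimage is a proper subspace, hence of lower dimension.\<close>

lemma negligible_linear_preimage:
  fixes f :: "'a::euclidean_space \<Rightarrow> 'b::euclidean_space"
  assumes "linear f" "subspace W" "f x \<notin> W"
  shows "negligible {y. f y \<in> W}"
proof -
  have sub: "subspace {y. f y \<in> W}"
    using assms(1,2) by (rule linear_subspace_linear_preimage)
  have "dim {y. f y \<in> W} \<noteq> DIM('a)"
  proof
    assume "dim {y. f y \<in> W} = DIM('a)"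
    then have "{y. f y \<in> W} = UNIV"
      using sub dim_eq_full span_eq_iff by metis
    then show False using assms(3) by auto
  qed
  then have "dim {y. f y \<in> W} < DIM('a)"
    using dim_subset_UNIV[of "{y. f y \<in> W}"] by linarith
  then show ?thesis by (rule negligible_lowdim)
qed

context spd_pencil
begin

section \<open>Compactness of the B-sphere and distance to \<open>G_max\<close>\<close>

lemma B_sphere_bounded: obtains K where "K > 0" "\<And>v. v \<bullet> (B *v v) = 1 \<Longrightarrow> norm v \<le> K"
proof -
  have "continuous_on (sphere 0 1) (\<lambda>v. v \<bullet> (B *v v))"
    by (intro continuous_intros matrix_vector_mult_linear_continuous_on)
  moreover have "sphere (0::real^'n) 1 \<noteq> {}" "compact (sphere (0::real^'n) 1)" by auto
  ultimately obtain u where u: "u \<in> sphere 0 1"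
    "\<And>v. v \<in> sphere 0 1 \<Longrightarrow> u \<bullet> (B *v u) \<le> v \<bullet> (B *v v)"
    using continuous_attains_inf[of "sphere 0 1" "\<lambda>v. v \<bullet> (B *v v)"] by blast
  define m where "m = u \<bullet> (B *v u)"
  have "u \<noteq> 0" using u(1) by auto
  then have m: "m > 0" by (simp add: m_def B_pos)
  show ?thesis
  proof (rule that)
    show "1 / sqrt m > 0" using m by simp
    fix v assume v: "v \<bullet> (B *v v) = 1"
    then have n: "norm v > 0" by auto
    have "m \<le> (v /\<^sub>R norm v) \<bullet> (B *v (v /\<^sub>R norm v))"
      using u(2)[of "v /\<^sub>R norm v"] n by (simp add: m_def)
    also have "\<dots> = 1 / (norm v)\<^sup>2"
      using v by (simp add: matrix_vector_mult_scaleR power2_eq_square field_simps)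
    finally have "(norm v)\<^sup>2 \<le> 1 / m"
      using m n by (simp add: field_simps)
    then show "norm v \<le> 1 / sqrt m"
      using real_le_rsqrt by (fastforce simp: real_sqrt_divide)
  qed
qed

lemma compact_B_sphere: "compact {v. v \<bullet> (B *v v) = 1}"
proof -
  have "continuous_on UNIV (\<lambda>v. v \<bullet> (B *v v))"
    by (intro continuous_intros matrix_vector_mult_linear_continuous_on)
  then have "closed {v. v \<bullet> (B *v v) = 1}"
    by (rule closed_Collect_eq) (rule continuous_on_const)
  moreover have "bounded {v. v \<bullet> (B *v v) = 1}"
    using B_sphere_bounded unfolding bounded_iff by (metis (mono_tags) mem_Collect_eq)
  ultimately show ?thesis by (simp add: compact_eq_bounded_closed)
qed

text \<open>The B-normalized points at distance at least \<open>e\<close> from \<open>G_max\<close>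
  form a compact set. If it is nonempty, the quotient attains a maximum on it, which is below
  \<open>\<rho>\<close> because maximizers lie in \<open>G_max\<close>; the sequence eventually
  exceeds that maximum.\<close>

lemma infdist_G_max_tendsto:
  assumes "\<And>k. v k \<bullet> (B *v v k) = 1" "(\<lambda>k::nat. r (v k)) \<longlonglongrightarrow> \<rho>"
  shows "(\<lambda>k. infdist (v k) (G_max A B)) \<longlonglongrightarrow> 0"
proof (rule order_tendstoI)
  show "\<forall>\<^sub>F k in sequentially. a < infdist (v k) (G_max A B)" if "a < 0" for a
    using that infdist_nonneg by (metis (mono_tags) always_eventually order_less_le_trans)
next
  fix e :: real assume "e > 0"
  define K where "K = {u. u \<bullet> (B *v u) = 1} \<inter> {u. e \<le> infdist u (G_max A B)}"
  have "closed {u. e \<le> infdist u (G_max A B)}"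
    by (intro closed_Collect_le continuous_intros)
  then have K: "compact K"
    unfolding K_def by (rule compact_Int_closed[OF compact_B_sphere])
  have K0: "u \<noteq> 0" if "u \<in> K" for u
    using that by (auto simp: K_def)
  show "\<forall>\<^sub>F k in sequentially. infdist (v k) (G_max A B) < e"
  proof (cases "K = {}")
    case True
    then have "infdist (v k) (G_max A B) < e" for k
      using assms(1)[of k] unfolding K_def by force
    then show ?thesis by simp
  next
    case False
    have "continuous_on K r"
      using continuous_rayleigh by (rule continuous_on_subset) (use K0 in auto)
    then obtain u where u: "u \<in> K" "\<And>w. w \<in> K \<Longrightarrow> r w \<le> r u"
      using continuous_attains_sup[OF K False] by blast
    have "u \<notin> G_max A B"
      using u(1) \<open>e > 0\<close> by (auto simp: K_def)
    then have "r u < \<rho>"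
      using maximizer_in_G_max rayleigh_le_max K0[OF u(1)] by fastforce
    then have "\<forall>\<^sub>F k in sequentially. r u < r (v k)"
      using assms(2) by (simp add: order_tendsto_iff)
    then show ?thesis
    proof eventually_elim
      case (elim k)
      then have "v k \<notin> K" using u(2) by force
      then show ?case using assms(1)[of k] by (auto simp: K_def)
    qed
  qed
qed

text \<open>If \<open>v\<close> and the eigenspace of \<open>l\<close> spanned everything, then \<open>A\<^sup>H - l B\<close> would be negative
  semidefinite, so that \<open>l = \<rho>\<close>, and the eigenspace of \<open>\<rho>\<close> would have codimension at most one.\<close>

lemma span_insert_eigenspace_neq_UNIV:
  assumes dim: "dim (G_max A B \<union> {0}) < CARD('n) - 1"
    and v: "v \<bullet> (B *v v) = 1" and l: "l \<in> eigenvalues" "l > r v"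
  shows "span (insert v (eigenspace l)) \<noteq> UNIV"
proof
  assume span: "span (insert v (eigenspace l)) = UNIV"
  obtain e where e: "e \<in> eigenspace l" "e \<noteq> 0"
    using l(1) by (auto simp: eigenvalues_def)
  have le: "r y \<le> l" if "y \<noteq> 0" for y
  proof -
    obtain s where s: "y - s *\<^sub>R v \<in> span (eigenspace l)"
      using span span_breakdown_eq[of y v "eigenspace l"] by auto
    then have g: "y - s *\<^sub>R v \<in> eigenspace l"
      using subspace_eigenspace by (simp add: span_eq_iff[THEN iffD2])
    define g where "g = y - s *\<^sub>R v"
    define m where "m = (\<lambda>x. S *v x - l *\<^sub>R (B *v x))"
    have y: "y = s *\<^sub>R v + g" by (simp add: g_def)
    have mg: "m g = 0" using g by (simp add: m_def eigenspace_def g_def)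
    have my: "m y = s *\<^sub>R m v"
      using mg unfolding y m_def
      by (simp add: matrix_vector_right_distrib matrix_vector_mult_scaleR algebra_simps)
    \<comment> \<open>The form is symmetric and \<open>m g = 0\<close>, so the cross terms vanish
      and only the contribution of \<open>v\<close> remains, with the factor
      \<open>r v - l < 0\<close>.\<close>
    have "g \<bullet> m v = v \<bullet> m g"
      using S_comm[of v g] B_comm[of v g] by (simp add: m_def inner_diff_right)
    then have "y \<bullet> m y = s\<^sup>2 * (v \<bullet> m v)"
      using mg unfolding my by (simp add: y inner_add_left power2_eq_square)
    also have "v \<bullet> m v = r v - l"
      using v by (simp add: m_def inner_diff_right rayleigh_symm)
    finally have "y \<bullet> m y \<le> 0"
      using l(2) by (simp add: mult_nonneg_nonpos)
    then show ?thesis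
      using B_pos[OF that] by (simp add: m_def inner_diff_right rayleigh_symm field_simps)
  qed
  obtain g where g: "g \<noteq> 0" "r g = \<rho>" using rayleigh_max_attained by blast
  have "\<rho> = l"
    using le[OF g(1)] g(2) rayleigh_le_max[OF e(2)] rayleigh_eigenspace[OF e] by simp
  have "CARD('n) = dim (insert v (eigenspace l))"
    using span by (metis dim_span dim_UNIV DIM_cart DIM_real mult.right_neutral)
  also have "\<dots> \<le> Suc (dim (eigenspace l))"
    by (simp add: dim_insert)
  also have "\<dots> < CARD('n)"
    using dim unfolding eigenspace_max \<open>\<rho> = l\<close> by linarith
  finally show False by simp
qed

section \<open>One step: increase, regularity and uniform improvement\<close>

lemma zo_step_eq:
  assumes v: "v \<bullet> (B *v v) = 1" and b: "search_dir B v y \<bullet> (S *v v) \<noteq> 0"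
  defines "x \<equiv> search_dir B v y"
  defines "w \<equiv> v + step_formula A B v x *\<^sub>R x"
  shows "zo_step A B v y = w /\<^sub>R normB B w" "w \<noteq> 0" "x \<bullet> (B *v v) = 0" "r v < r w"
    "step_size A B v x = step_formula A B v x"
proof -
  have v0: "v \<noteq> 0" using v by auto
  note x = search_dir_props[OF v0 b, folded x_def]
  show "zo_step A B v y = w /\<^sub>R normB B w"
    by (simp add: zo_step_def x_def w_def Let_def)
  show "x \<bullet> (B *v v) = 0" by (rule x(2))
  show "w \<noteq> 0" "r v < r w" "step_size A B v x = step_formula A B v x"
    unfolding w_def
    using line_nonzero[OF v x(2)] line_increase[OF v x(2)] step_size_eq[OF v x(2)] b
    by (auto simp: x_def)
qed

lemma zo_step_normalized:
  assumes "v \<bullet> (B *v v) = 1" "search_dir B v y \<bullet> (S *v v) \<noteq> 0"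
  shows "zo_step A B v y \<bullet> (B *v zo_step A B v y) = 1"
  using zo_step_eq(1,2)[OF assms] normB_normalized by simp

lemma rayleigh_zo_step:
  assumes "v \<bullet> (B *v v) = 1" "search_dir B v y \<bullet> (S *v v) \<noteq> 0"
  shows "r (zo_step A B v y) = r (v + step_formula A B v (search_dir B v y) *\<^sub>R search_dir B v y)"
  using zo_step_eq(1)[OF assms] normB_pos[OF zo_step_eq(2)[OF assms]]
  by (simp add: rayleigh_scale)

text \<open>If the new state were an eigenvector for \<open>l\<close>, strict increase would give
  \<open>l > r v\<close>, and solving \<open>w = v + t x\<close> for \<open>x\<close> would put the
  projected sample into the span excluded by \<open>avoid\<close>.\<close>

lemma regular_zo_step:
  assumes v: "v \<bullet> (B *v v) = 1" and b: "search_dir B v y \<bullet> (S *v v) \<noteq> 0"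
    and avoid: "\<And>l. l \<in> eigenvalues \<Longrightarrow> l > r v \<Longrightarrow>
      projT B v y \<notin> span (insert v (eigenspace l))"
  shows "regular_state A B (zo_step A B v y)"
  unfolding regular_state_def
proof (intro conjI allI notI zo_step_normalized[OF v b])
  fix l
  define x where "x = search_dir B v y"
  define t where "t = step_formula A B v x"
  define w where "w = v + t *\<^sub>R x"
  assume *: "S *v zo_step A B v y = l *\<^sub>R (B *v zo_step A B v y)"
  note st = zo_step_eq[OF v b, folded x_def, folded t_def, folded w_def]
  have n: "normB B w > 0" by (rule normB_pos[OF st(2)])
  have "zo_step A B v y \<in> eigenspace l" using * by (simp add: eigenspace_def)
  then have "normB B w *\<^sub>R zo_step A B v y \<in> eigenspace l"
    by (rule subspace_scale[OF subspace_eigenspace])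
  then have w: "w \<in> eigenspace l" using n by (simp add: st(1))
  then have "l \<in> eigenvalues" using st(2) by (auto simp: eigenvalues_def)
  moreover have "l > r v" using st(4) rayleigh_eigenspace[OF w st(2)] by simp
  moreover have "projT B v y \<in> span (insert v (eigenspace l))"
  proof -
    have "t \<noteq> 0" using st(4) by (auto simp: w_def)
    have "w \<in> span (insert v (eigenspace l))" "v \<in> span (insert v (eigenspace l))"
      using w by (auto intro: span_base)
    then have "(inverse t) *\<^sub>R (w - v) \<in> span (insert v (eigenspace l))"
      by (intro span_scale span_diff)
    then have "x \<in> span (insert v (eigenspace l))"
      using \<open>t \<noteq> 0\<close> by (simp add: w_def)
    moreover have "projT B v y = norm (projT B v y) *\<^sub>R x"
      unfolding x_def using search_dir_props(4)[OF _ b] v by fastforce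
    ultimately show ?thesis by (metis span_scale)
  qed
  ultimately show False using avoid by blast
qed

text \<open>A bad sample is projected into the hyperplane orthogonal to \<open>S *v v\<close> or
  into the span of \<open>v\<close> and an eigenspace above \<open>r v\<close>. These are finitely
  many conditions, each defining a proper subspace.\<close>

lemma negligible_bad_samples:
  assumes dim: "dim (G_max A B \<union> {0}) < CARD('n) - 1" and v: "regular_state A B v"
  shows "negligible {y. \<not> (search_dir B v y \<bullet> (S *v v) \<noteq> 0 \<and> regular_state A B (zo_step A B v y))}"
proof -
  note v1 = regular_stateD[OF v]
  define L where "L = {l \<in> eigenvalues. l > r v}"
  define W where "W = (\<lambda>l. span (insert v (eigenspace l)))"
  have "negligible {y. projT B v y \<in> {z. (S *v v) \<bullet> z = 0}}"
  proof (rule negligible_linear_preimage[OF linear_projT subspace_hyperplane])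
    \<comment> \<open>The sample \<open>S *v v\<close> is itself outside: its pairing is the squared
      norm of its projection, nonzero by regularity.\<close>
    have "(S *v v) \<bullet> projT B v (S *v v) = projT B v (S *v v) \<bullet> projT B v (S *v v)"
      using projT_fixes[OF projT_orth[OF v1(2)]] by (simp add: projT_self_adjoint)
    then show "projT B v (S *v v) \<notin> {z. (S *v v) \<bullet> z = 0}"
      using regular_state_projT[OF v] by simp
  qed
  moreover have "negligible {y. projT B v y \<in> W l}" if "l \<in> L" for l
  proof -
    have "\<exists>y. projT B v y \<notin> W l"
    proof (rule ccontr)
      assume "\<not> ?thesis"
      then have all: "projT B v y \<in> W l" for y by blast
      have vW: "v \<in> W l" by (simp add: W_def span_base)
      have "y \<in> W l" for y
      proof -
        \<comment> \<open>As \<open>v\<close> is B-normalized, this difference is tangent and fixed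
          by the projection. Hence \<open>W l\<close>, containing \<open>v\<close> and the range of
          the projection, would be the whole space.\<close>
        have "y - (y \<bullet> (B *v v)) *\<^sub>R v \<in> W l"
          using all[of "y - (y \<bullet> (B *v v)) *\<^sub>R v"] v1(1)
          by (simp add: projT_fixes inner_diff_left)
        then have "y - (y \<bullet> (B *v v)) *\<^sub>R v + (y \<bullet> (B *v v)) *\<^sub>R v \<in> W l"
          using vW unfolding W_def by (intro span_add span_scale)
        then show ?thesis by simp
      qed
      then show False
        using span_insert_eigenspace_neq_UNIV[OF dim v1(1), of l] that by (auto simp: L_def W_def)
    qed
    then show ?thesis
      using negligible_linear_preimage[OF linear_projT] by (auto simp: W_def)
  qed
  then have "negligible (\<Union>l\<in>L. {y. projT B v y \<in> W l})"
    using finite_eigenvalues by (intro negligible_Union) (auto simp: L_def)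
  ultimately have "negligible ({y. projT B v y \<in> {z. (S *v v) \<bullet> z = 0}} \<union> (\<Union>l\<in>L. {y. projT B v y \<in> W l}))"
    by (rule negligible_Un)
  then show ?thesis
  proof (rule negligible_subset, intro subsetI)
    fix y
    assume y: "y \<in> {y. \<not> (search_dir B v y \<bullet> (S *v v) \<noteq> 0 \<and> regular_state A B (zo_step A B v y))}"
    show "y \<in> {y. projT B v y \<in> {z. (S *v v) \<bullet> z = 0}} \<union> (\<Union>l\<in>L. {y. projT B v y \<in> W l})"
    proof (cases "(S *v v) \<bullet> projT B v y = 0")
      case False
      then have "search_dir B v y \<bullet> (S *v v) \<noteq> 0"
        by (auto simp: search_dir_def inner_commute)
      then show ?thesis
        using regular_zo_step[OF v1(1)] y by (auto simp: L_def W_def)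
    qed simp
  qed
qed

text \<open>The constants do not depend on \<open>v\<close>: \<open>\<delta>\<close> comes from
  continuity of \<open>r\<close> at a single maximizer \<open>g\<close>, and \<open>C\<close> from
  bounds on the whole B-sphere. This yields a success probability common to all states.\<close>

lemma improving_ball:
  assumes "c < \<rho>"
  obtains \<delta> C where "\<delta> > 0" "\<And>v. v \<bullet> (B *v v) = 1 \<Longrightarrow> \<exists>z. norm z \<le> C \<and>
    (\<forall>y\<in>ball z \<delta>. search_dir B v y \<bullet> (S *v v) \<noteq> 0 \<longrightarrow> c < r (zo_step A B v y))"
proof -
  obtain g where g: "g \<in> G_max A B" "g \<noteq> 0" "r g = \<rho>" by (rule G_max_nonempty)
  have "isCont r g"
    using continuous_rayleigh g(2) continuous_on_eq_continuous_at[of "- {0::real^'n}" r] by auto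
  then have "\<forall>\<^sub>F w in at g. c < r w"
    using g(3) assms by (auto simp: isCont_def order_tendsto_iff)
  then obtain d where d: "d > 0" "\<And>w. w \<noteq> g \<Longrightarrow> dist w g < d \<Longrightarrow> c < r w"
    by (auto simp: eventually_at)
  then have near: "c < r w" if "dist w g < d" for w
    using that g(3) assms by (cases "w = g") auto
  obtain K where K: "K > 0" "\<And>v. v \<bullet> (B *v v) = 1 \<Longrightarrow> norm v \<le> K"
    using B_sphere_bounded by blast
  obtain L where L: "L > 0" "\<And>x. norm (B *v x) \<le> L * norm x"
    using linear_bounded_pos[OF matrix_vector_mul_linear, of B] by auto
  show ?thesis
  proof (rule that)
    \<comment> \<open>Half of the radius \<open>d\<close> is left for the deviation of the sample,
      half for replacing \<open>s\<close> by \<open>s'\<close>.\<close>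
    show "d / 2 > 0" using d(1) by simp
    fix v assume v: "v \<bullet> (B *v v) = 1"
    then have v0: "v \<noteq> 0" by auto
    define s where "s = g \<bullet> (B *v v)"
    define z where "z = g - s *\<^sub>R v"
    \<comment> \<open>\<open>s'\<close> is a nonzero perturbation of \<open>s\<close>, so that \<open>s' v + p\<close> below is a multiple of a point on
      the search line.\<close>
    define s' where "s' = (if s = 0 then d / (4 * K) else s)"
    have s': "s' \<noteq> 0" "\<bar>s' - s\<bar> * norm v < d / 2"
    proof -
      show "s' \<noteq> 0" using d(1) K(1) by (simp add: s'_def)
      have "\<bar>s' - s\<bar> * norm v \<le> (d / (4 * K)) * K"
        using K(2)[OF v] K(1) d(1) by (intro mult_mono) (auto simp: s'_def)
      then show "\<bar>s' - s\<bar> * norm v < d / 2" using K(1) d(1) by simp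
    qed
    have "norm z \<le> norm g + \<bar>s\<bar> * norm v"
      unfolding z_def by (metis norm_scaleR norm_triangle_ineq4)
    also have "\<bar>s\<bar> * norm v \<le> (norm g * (L * K)) * K"
    proof (intro mult_mono)
      have "\<bar>s\<bar> \<le> norm g * norm (B *v v)" unfolding s_def by (rule Cauchy_Schwarz_ineq2)
      also have "norm (B *v v) \<le> L * K"
        using L(2)[of v] mult_left_mono[OF K(2)[OF v], of L] L(1) by linarith
      finally show "\<bar>s\<bar> \<le> norm g * (L * K)" by (simp add: mult_left_mono)
    qed (use K L v in auto)
    finally have zC: "norm z \<le> norm g + (norm g * (L * K)) * K" by simp
    have zT: "z \<bullet> (B *v v) = 0" using v by (simp add: z_def s_def inner_diff_left)
    have "c < r (zo_step A B v y)" if y: "y \<in> ball z (d/2)" and b: "search_dir B v y \<bullet> (S *v v) \<noteq> 0" for y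
    proof -
      define x where "x = search_dir B v y"
      define p where "p = projT B v y"
      note x = search_dir_props[OF v0 b, folded x_def p_def]
      \<comment> \<open>The projection fixes \<open>z\<close> and is nonexpansive, so
        \<open>p\<close> is no farther from \<open>z\<close> than the sample.\<close>
      have "projT B v (y - z) = p - z"
        using linear_diff[OF linear_projT, of v y z] projT_fixes[OF zT] by (simp add: p_def)
      then have pz: "norm (p - z) < d / 2"
        using projT_norm_le[OF v0, of "y - z"] y by (simp add: dist_norm norm_minus_commute)
      have "dist (s' *\<^sub>R v + p) g = norm ((p - z) + (s' - s) *\<^sub>R v)"
        by (simp add: z_def algebra_simps dist_norm)
      also have "\<dots> < d"
        using norm_triangle_ineq[of "p - z" "(s' - s) *\<^sub>R v"] pz s'(2) by simp
      finally have "dist (s' *\<^sub>R v + p) g < d" .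
      then have "c < r (s' *\<^sub>R v + p)" by (rule near)
      \<comment> \<open>Factoring out \<open>s'\<close> leaves a point of the search line, with
        parameter \<open>norm p / s'\<close>; the exact line search does at least as well.\<close>
      also have "s' *\<^sub>R v + p = s' *\<^sub>R (v + (norm p / s') *\<^sub>R x)"
        using x(4) s'(1) by (simp add: scaleR_add_right)
      also have "r \<dots> = r (v + (norm p / s') *\<^sub>R x)"
        using s'(1) by (rule rayleigh_scale)
      also have "\<dots> \<le> r (zo_step A B v y)"
        using line_max_le[OF v x(2)] b unfolding rayleigh_zo_step[OF v b] by (simp add: x_def)
      finally show ?thesis .
    qed
    then show "\<exists>z. norm z \<le> norm g + (norm g * (L * K)) * K \<and>
      (\<forall>y\<in>ball z (d/2). search_dir B v y \<bullet> (S *v v) \<noteq> 0 \<longrightarrow> c < r (zo_step A B v y))"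
      using zC by blast
  qed
qed

end

section \<open>Independent pairs and the standard Gaussian measure\<close>

text \<open>Independence makes the joint law a product, so a property of almost every sample at
  almost every fixed state passes to the random state.\<close>

lemma (in prob_space) AE_indep_var_pair:
  assumes ind: "indep_var S X T Y"
    and meas: "Measurable.pred (S \<Otimes>\<^sub>M T) (\<lambda>z. P (fst z) (snd z))"
    and ae: "AE v in distr M S X. AE y in distr M T Y. P v y"
  shows "AE \<omega> in M. P (X \<omega>) (Y \<omega>)"
proof -
  note rv = indep_var_rv1[OF ind] indep_var_rv2[OF ind]
  interpret X: prob_space "distr M S X" by (rule prob_space_distr[OF rv(1)])
  interpret Y: prob_space "distr M T Y" by (rule prob_space_distr[OF rv(2)])
  interpret XY: pair_prob_space "distr M S X" "distr M T Y" ..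
  have "AE z in distr M S X \<Otimes>\<^sub>M distr M T Y. P (fst z) (snd z)"
  proof (rule XY.AE_pair_measure)
    show "{z \<in> space (distr M S X \<Otimes>\<^sub>M distr M T Y). P (fst z) (snd z)}
      \<in> sets (distr M S X \<Otimes>\<^sub>M distr M T Y)"
      using meas by (simp add: pred_def space_pair_measure cong: sets_pair_measure_cong)
  qed (use ae in simp)
  then have "AE z in distr M (S \<Otimes>\<^sub>M T) (\<lambda>\<omega>. (X \<omega>, Y \<omega>)). P (fst z) (snd z)"
    using ind unfolding indep_var_distribution_eq by metis
  then show ?thesis
    using meas rv by (subst (asm) AE_distr_iff) (auto simp: pred_def)
qed

text \<open>The section bound is integrated over the law of \<open>X\<close>. In the application
  \<open>U\<close> says that the present state does not exceed a level, and \<open>Q\<close> that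
  the next one does not.\<close>

lemma (in prob_space) emeasure_indep_var_pair_le:
  assumes ind: "indep_var S X T Y" and Q: "Q \<in> sets (S \<Otimes>\<^sub>M T)" and U: "U \<in> sets S"
    and le: "AE v in distr M S X. emeasure (distr M T Y) (Pair v -` Q) \<le> q * indicator U v"
  shows "emeasure M {\<omega> \<in> space M. (X \<omega>, Y \<omega>) \<in> Q} \<le> q * emeasure M {\<omega> \<in> space M. X \<omega> \<in> U}"
proof -
  note rv = indep_var_rv1[OF ind] indep_var_rv2[OF ind]
  interpret X: prob_space "distr M S X" by (rule prob_space_distr[OF rv(1)])
  interpret Y: prob_space "distr M T Y" by (rule prob_space_distr[OF rv(2)])
  have "emeasure M {\<omega> \<in> space M. (X \<omega>, Y \<omega>) \<in> Q} =
      emeasure (distr M (S \<Otimes>\<^sub>M T) (\<lambda>\<omega>. (X \<omega>, Y \<omega>))) Q"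
    using rv Q by (subst emeasure_distr) (auto intro!: arg_cong[where f = "emeasure M"])
  also have "\<dots> = emeasure (distr M S X \<Otimes>\<^sub>M distr M T Y) Q"
    using ind by (simp add: indep_var_distribution_eq)
  also have "\<dots> = (\<integral>\<^sup>+v. emeasure (distr M T Y) (Pair v -` Q) \<partial>distr M S X)"
    using Q by (intro Y.emeasure_pair_measure_alt) (simp cong: sets_pair_measure_cong)
  also have "\<dots> \<le> (\<integral>\<^sup>+v. q * indicator U v \<partial>distr M S X)"
    by (rule nn_integral_mono_AE[OF le])
  also have "\<dots> = q * emeasure (distr M S X) U"
    using U by (simp add: nn_integral_cmult_indicator)
  also have "\<dots> = q * emeasure M {\<omega> \<in> space M. X \<omega> \<in> U}"
    using rv U by (subst emeasure_distr) (auto intro!: arg_cong[where f = "emeasure M"] arg_cong2[where f = "(*)"])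
  finally show ?thesis .
qed

abbreviation std_gaussian :: "(real^'n) measure" where
  "std_gaussian \<equiv> density lborel (\<lambda>x. ennreal (std_gaussian_density x))"

lemma std_gaussian_density_measurable [measurable]: "std_gaussian_density \<in> borel_measurable borel"
  unfolding std_gaussian_density_def by measurable

text \<open>The Gaussian law has a Lebesgue density, so Lebesgue null sets are null for it.\<close>

lemma AE_std_gaussian:
  assumes "negligible {y. \<not> P y}"
  shows "AE y in std_gaussian. P y"
proof -
  have "AE y in lebesgue. P y"
    using assms by (intro AE_I'[of "{y. \<not> P y}"]) (auto simp: negligible_iff_null_sets)
  then have "AE y in lborel. P y" by (simp add: AE_completion_iff)
  then show ?thesis by (subst AE_density) auto
qed

lemma std_gaussian_ball_ge:
  assumes "\<delta> > 0"
  obtains p where "p > 0" "\<And>z::real^'n. norm z \<le> C \<Longrightarrow> ennreal p \<le> emeasure std_gaussian (ball z \<delta>)"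
proof
  \<comment> \<open>The density at radius \<open>C + \<delta>\<close>, which bounds it below on
    every ball in question.\<close>
  define c where "c = exp (- (C + \<delta>)\<^sup>2 / 2) / sqrt (2 * pi) ^ CARD('n)"
  have c: "c > 0" by (simp add: c_def)
  define vol where "vol = unit_ball_vol (real CARD('n)) * \<delta> ^ CARD('n)"
  have vol: "vol > 0" using assms by (simp add: vol_def)
  show "c * vol > 0" using c vol by simp
  fix z :: "real^'n" assume z: "norm z \<le> C"
  have "ennreal (c * vol) = ennreal c * emeasure lborel (ball z \<delta>)"
    using assms c vol by (simp add: emeasure_ball vol_def ennreal_mult')
  also have "\<dots> = (\<integral>\<^sup>+x. ennreal c * indicator (ball z \<delta>) x \<partial>lborel)"
    by (simp add: nn_integral_cmult_indicator)
  also have "\<dots> \<le> (\<integral>\<^sup>+x. ennreal (std_gaussian_density x) * indicator (ball z \<delta>) x \<partial>lborel)"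
  proof (rule nn_integral_mono)
    fix x :: "real^'n"
    have "c \<le> std_gaussian_density x" if "x \<in> ball z \<delta>"
    proof -
      have "norm x \<le> norm z + norm (x - z)" by (metis add.commute diff_add_cancel norm_triangle_ineq)
      then have "norm x \<le> C + \<delta>" using that z by (simp add: dist_norm norm_minus_commute)
      then have "(norm x)\<^sup>2 \<le> (C + \<delta>)\<^sup>2" by (intro power_mono) auto
      then show ?thesis
        unfolding c_def std_gaussian_density_def by (intro divide_right_mono) auto
    qed
    then show "ennreal c * indicator (ball z \<delta>) x \<le> ennreal (std_gaussian_density x) * indicator (ball z \<delta>) x"
      by (auto simp: indicator_def intro: ennreal_leI)
  qed
  also have "\<dots> = emeasure std_gaussian (ball z \<delta>)"
    by (subst emeasure_density) auto
  finally show "ennreal (c * vol) \<le> emeasure std_gaussian (ball z \<delta>)" .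
qed

lemma distr_std_gaussian:
  assumes "distributed M lborel Y std_gaussian_density"
  shows "distr M borel Y = std_gaussian"
proof -
  have "distr M borel Y = distr M lborel Y" by (rule distr_cong) auto
  then show ?thesis using distributed_distr_eq_density[OF assms] by simp
qed

section \<open>Measurability of the step map\<close>

lemma matrix_vector_mult_measurable [measurable (raw)]:
  fixes C :: "real^'n^'m"
  assumes "f \<in> borel_measurable M"
  shows "(\<lambda>x. C *v f x) \<in> borel_measurable M"
  by (rule borel_measurable_continuous_on[OF _ assms])
    (rule matrix_vector_mult_linear_continuous_on)

lemma projT_measurable [measurable (raw)]:
  assumes [measurable]: "f \<in> borel_measurable M" "g \<in> borel_measurable M"
  shows "(\<lambda>x. projT B (f x) (g x)) \<in> borel_measurable M"
  unfolding projT_def by measurable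

lemma rayleigh_measurable [measurable (raw)]:
  assumes [measurable]: "f \<in> borel_measurable M"
  shows "(\<lambda>x. rayleigh A B (f x)) \<in> borel_measurable M"
  unfolding rayleigh_def by measurable

lemma search_dir_measurable [measurable (raw)]:
  assumes [measurable]: "f \<in> borel_measurable M" "g \<in> borel_measurable M"
  shows "(\<lambda>x. search_dir B (f x) (g x)) \<in> borel_measurable M"
  unfolding search_dir_def by measurable

lemma zo_step_measurable [measurable (raw)]:
  assumes [measurable]: "f \<in> borel_measurable M" "g \<in> borel_measurable M"
  shows "(\<lambda>x. zo_step A B (f x) (g x)) \<in> borel_measurable M"
  unfolding zo_step_def step_formula_def line_max_def normB_def Let_def by measurable

section \<open>The random process\<close>

text \<open>Index \<open>0\<close> of the sample sequence is the initialization, index \<open>Suc k\<close> the sample of step \<open>k\<close>.\<close>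

primrec zo_state :: "real^'n^'n \<Rightarrow> real^'n^'n \<Rightarrow> (nat \<Rightarrow> real^'n) \<Rightarrow> nat \<Rightarrow> real^'n" where
  "zo_state A B f 0 = f 0 /\<^sub>R normB B (f 0)"
| "zo_state A B f (Suc k) = zo_step A B (zo_state A B f k) (f (Suc k))"

text \<open>State \<open>k\<close> reads no sample beyond index \<open>k\<close>; independence will
  be applied to this block of indices.\<close>

lemma zo_state_restrict: "{..k} \<subseteq> I \<Longrightarrow> zo_state A B (restrict f I) k = zo_state A B f k"
proof (induction k)
  case (Suc k)
  then have "{..k} \<subseteq> I" "Suc k \<in> I" by auto
  then show ?case using Suc.IH by simp
qed auto

lemma zo_state_measurable:
  "{..k} \<subseteq> I \<Longrightarrow> (\<lambda>f. zo_state A B f k) \<in> borel_measurable (PiM I (\<lambda>_. borel))"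
proof (induction k)
  case 0
  then have [measurable]: "(\<lambda>f. f 0) \<in> borel_measurable (PiM I (\<lambda>_. borel))"
    by (intro measurable_component_singleton) auto
  show ?case unfolding zo_state.simps normB_def by measurable
next
  case (Suc k)
  then have [measurable]: "(\<lambda>f. f (Suc k)) \<in> borel_measurable (PiM I (\<lambda>_. borel))"
    by (intro measurable_component_singleton) auto
  have [measurable]: "(\<lambda>f. zo_state A B f k) \<in> borel_measurable (PiM I (\<lambda>_. borel))"
    using Suc by (intro Suc.IH) auto
  show ?case by simp
qed

locale zo_process = spd_pencil A B + prob_space M
  for A B :: "real^'n^'n" and M :: "'w measure" +
  fixes vt :: "'w \<Rightarrow> real^'n" and xt :: "nat \<Rightarrow> 'w \<Rightarrow> real^'n"
  assumes vt_normal: "distributed M lborel vt std_gaussian_density"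
    and xt_normal: "\<And>k. distributed M lborel (xt k) std_gaussian_density"
    and indep: "indep_vars (\<lambda>_. borel) (\<lambda>i. case i of 0 \<Rightarrow> vt | Suc k \<Rightarrow> xt k) UNIV"
    and dim_G_max: "dim (G_max A B \<union> {0}) < CARD('n) - 1"
begin

definition V :: "nat \<Rightarrow> 'w \<Rightarrow> real^'n" where
  "V k \<omega> = zo_state A B (\<lambda>i. (case i of 0 \<Rightarrow> vt | Suc k \<Rightarrow> xt k) \<omega>) k"

lemma V_0: "V 0 \<omega> = vt \<omega> /\<^sub>R normB B (vt \<omega>)"
  by (simp add: V_def)

lemma V_Suc: "V (Suc k) \<omega> = zo_step A B (V k \<omega>) (xt k \<omega>)"
  by (simp add: V_def)

text \<open>\<open>V k\<close> depends on the samples up to index \<open>k\<close>, while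
  \<open>xt k\<close> has index \<open>Suc k\<close>, as the initialization occupies
  \<open>0\<close>. Disjoint blocks of an independent family are independent.\<close>

lemma indep_state_sample: "indep_var borel (V k) borel (xt k)"
proof -
  let ?X = "\<lambda>i. case i of 0 \<Rightarrow> vt | Suc k \<Rightarrow> xt k"
  have "indep_var (PiM {..k} (\<lambda>_. borel)) (\<lambda>\<omega>. restrict (\<lambda>i. ?X i \<omega>) {..k})
      (PiM {Suc k} (\<lambda>_. borel)) (\<lambda>\<omega>. restrict (\<lambda>i. ?X i \<omega>) {Suc k})"
    by (rule indep_var_restrict[OF indep]) auto
  then have "indep_var borel ((\<lambda>f. zo_state A B f k) \<circ> (\<lambda>\<omega>. restrict (\<lambda>i. ?X i \<omega>) {..k}))
      borel ((\<lambda>f. f (Suc k)) \<circ> (\<lambda>\<omega>. restrict (\<lambda>i. ?X i \<omega>) {Suc k}))"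
    by (rule indep_var_compose) (auto intro: zo_state_measurable measurable_component_singleton)
  moreover have "(\<lambda>f. zo_state A B f k) \<circ> (\<lambda>\<omega>. restrict (\<lambda>i. ?X i \<omega>) {..k}) = V k"
    by (auto simp: V_def zo_state_restrict fun_eq_iff)
  moreover have "(\<lambda>f. f (Suc k)) \<circ> (\<lambda>\<omega>. restrict (\<lambda>i. ?X i \<omega>) {Suc k}) = xt k"
    by (auto simp: fun_eq_iff)
  ultimately show ?thesis by simp
qed

lemma V_measurable [measurable]: "V k \<in> borel_measurable M"
  by (rule indep_var_rv1[OF indep_state_sample])

lemma xt_measurable [measurable]: "xt k \<in> borel_measurable M"
  by (rule indep_var_rv2[OF indep_state_sample])

section \<open>Almost sure regularity along the iteration\<close>

lemma regular_state_iff: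
  "regular_state A B v \<longleftrightarrow> v \<bullet> (B *v v) = 1 \<and> projT B v (S *v v) \<noteq> 0"
  using regular_state_projT[of v]
  by (auto simp: regular_state_def projT_def power2_norm_eq_inner)

text \<open>The form with \<open>projT\<close> replaces the quantifier over all real
  \<open>l\<close> by a single Borel condition.\<close>

lemma regular_state_measurable [measurable]: "Measurable.pred borel (regular_state A B)"
  unfolding regular_state_iff[abs_def] by measurable

lemma AE_regular_start: "AE \<omega> in M. regular_state A B (V 0 \<omega>)"
proof -
  have neq: "eigenspace l \<noteq> UNIV" for l
  proof
    assume U: "eigenspace l = UNIV"
    obtain g where g: "g \<in> G_max A B" "g \<noteq> 0" "r g = \<rho>" by (rule G_max_nonempty)
    \<comment> \<open>An eigenspace filling the whole space contains a maximizer and would be that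
      of \<open>\<rho>\<close>, against the dimension assumption.\<close>
    have "l = \<rho>" using rayleigh_eigenspace[of g l] g U by simp
    then show False using dim_G_max U unfolding eigenspace_max by simp
  qed
  have "negligible (eigenspace l)" for l
  proof -
    obtain x where "x \<notin> eigenspace l" using neq by blast
    then show ?thesis
      using negligible_linear_preimage[OF linear_id subspace_eigenspace[of l], of x] by simp
  qed
  then have "negligible ((\<Union>l\<in>eigenvalues. eigenspace l) \<union> {0})"
    by (intro negligible_Un negligible_Union) (use finite_eigenvalues in auto)
  then have "negligible {y. \<not> regular_state A B (y /\<^sub>R normB B y)}"
  proof (rule negligible_subset, intro subsetI)
    fix y assume y: "y \<in> {y. \<not> regular_state A B (y /\<^sub>R normB B y)}"
    show "y \<in> (\<Union>l\<in>eigenvalues. eigenspace l) \<union> {0}"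
    proof (cases "y = 0")
      case False
      then obtain l where "y /\<^sub>R normB B y \<in> eigenspace l"
        using y normB_normalized[OF False] by (auto simp: regular_state_def eigenspace_def)
      then have "normB B y *\<^sub>R (y /\<^sub>R normB B y) \<in> eigenspace l"
        by (rule subspace_scale[OF subspace_eigenspace])
      then have "y \<in> eigenspace l" using normB_pos[OF False] by simp
      then show ?thesis using False by (auto simp: eigenvalues_def)
    qed simp
  qed
  then have "AE y in distr M borel vt. regular_state A B (y /\<^sub>R normB B y)"
    unfolding distr_std_gaussian[OF vt_normal] by (rule AE_std_gaussian)
  moreover have "vt \<in> borel_measurable M"
    using distributed_measurable[OF vt_normal] by simp
  ultimately have "AE \<omega> in M. regular_state A B (vt \<omega> /\<^sub>R normB B (vt \<omega>))"
    by (subst (asm) AE_distr_iff) (auto simp: normB_def)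
  then show ?thesis by (simp add: V_0)
qed

lemma AE_sample_good:
  assumes "regular_state A B v"
  shows "AE y in distr M borel (xt k).
    search_dir B v y \<bullet> (S *v v) \<noteq> 0 \<and> regular_state A B (zo_step A B v y)"
  unfolding distr_std_gaussian[OF xt_normal]
  by (rule AE_std_gaussian[OF negligible_bad_samples[OF dim_G_max assms]])

lemma AE_regular_step:
  assumes "AE \<omega> in M. regular_state A B (V k \<omega>)"
  shows "AE \<omega> in M. search_dir B (V k \<omega>) (xt k \<omega>) \<bullet> (S *v V k \<omega>) \<noteq> 0 \<and>
    regular_state A B (V (Suc k) \<omega>)"
  unfolding V_Suc
proof (rule AE_indep_var_pair[OF indep_state_sample,
      where P = "\<lambda>v y. search_dir B v y \<bullet> (S *v v) \<noteq> 0 \<and> regular_state A B (zo_step A B v y)"])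
  have "AE v in distr M borel (V k). regular_state A B v"
    using assms by (subst AE_distr_iff) auto
  then show "AE v in distr M borel (V k). AE y in distr M borel (xt k).
      search_dir B v y \<bullet> (S *v v) \<noteq> 0 \<and> regular_state A B (zo_step A B v y)"
    by eventually_elim (rule AE_sample_good)
qed measurable

lemma AE_regular: "AE \<omega> in M. regular_state A B (V k \<omega>)"
proof (induction k)
  case (Suc k)
  show ?case using AE_regular_step[OF Suc] by eventually_elim simp
qed (rule AE_regular_start)

lemma AE_all_regular:
  "AE \<omega> in M. \<forall>k. regular_state A B (V k \<omega>) \<and> search_dir B (V k \<omega>) (xt k \<omega>) \<bullet> (S *v V k \<omega>) \<noteq> 0"
  unfolding AE_all_countable using AE_regular AE_regular_step[OF AE_regular]
  by (intro allI) (auto elim: AE_mp)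

text \<open>As \<open>r\<close> increases, failure at time \<open>Suc k\<close> requires failure at
  time \<open>k\<close>, and given any such regular state it has probability at most
  \<open>1 - p\<close>. Iteration gives the geometric bound.\<close>

lemma failure_probability:
  assumes "c < \<rho>"
  obtains p where "p > 0" "p \<le> 1"
    "\<And>k. emeasure M {\<omega> \<in> space M. r (V k \<omega>) \<le> c} \<le> ennreal ((1 - p) ^ k)"
proof -
  obtain \<delta> C where \<delta>: "\<delta> > 0" and ball: "\<And>v. v \<bullet> (B *v v) = 1 \<Longrightarrow> \<exists>z. norm z \<le> C \<and>
    (\<forall>y\<in>ball z \<delta>. search_dir B v y \<bullet> (S *v v) \<noteq> 0 \<longrightarrow> c < r (zo_step A B v y))"
    using improving_ball[OF assms] by blast
  obtain q where q: "q > 0" "\<And>z::real^'n. norm z \<le> C \<Longrightarrow> ennreal q \<le> emeasure std_gaussian (ball z \<delta>)"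
    using std_gaussian_ball_ge[OF \<delta>] by blast
  define p where "p = min q 1"
  have p: "p > 0" "p \<le> 1" using q(1) by (auto simp: p_def)
  have gauss: "prob_space (std_gaussian :: (real^'n) measure)"
    using prob_space_distr[OF xt_measurable] distr_std_gaussian[OF xt_normal] by metis
  interpret G: prob_space "std_gaussian :: (real^'n) measure" by (rule gauss)
  define Q where "Q = {z::(real^'n) \<times> (real^'n). r (zo_step A B (fst z) (snd z)) \<le> c}"
  have Q: "Q \<in> sets (borel \<Otimes>\<^sub>M borel)"
  proof -
    have "{z \<in> space (borel \<Otimes>\<^sub>M borel). r (zo_step A B (fst z) (snd z)) \<le> c} \<in> sets (borel \<Otimes>\<^sub>M borel)"
      by measurable
    then show ?thesis by (simp add: Q_def space_pair_measure)
  qed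
  define U where "U = {v. r v \<le> c}"
  have U: "U \<in> sets borel"
    unfolding U_def by measurable
  have step: "emeasure std_gaussian (Pair v -` Q) \<le> ennreal (1 - p) * indicator U v"
    if v: "regular_state A B v" for v
  proof -
    note v1 = regular_stateD(1)[OF v]
    have Qv: "Pair v -` Q \<in> sets borel" using Q by (rule sets_Pair1)
    have good: "AE y in std_gaussian. search_dir B v y \<bullet> (S *v v) \<noteq> 0"
      using AE_sample_good[OF v, of 0] unfolding distr_std_gaussian[OF xt_normal]
      by eventually_elim simp
    show ?thesis
    proof (cases "v \<in> U")
      case True
      obtain z where z: "norm z \<le> C"
        "\<And>y. y \<in> ball z \<delta> \<Longrightarrow> search_dir B v y \<bullet> (S *v v) \<noteq> 0 \<Longrightarrow> c < r (zo_step A B v y)"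
        using ball[OF v1] by blast
      \<comment> \<open>Almost every sample in the ball succeeds, so failures lie in its complement
        up to a null set.\<close>
      have "emeasure std_gaussian (Pair v -` Q) \<le> emeasure std_gaussian (- ball z \<delta>)"
      proof (rule emeasure_mono_AE)
        show "AE y in std_gaussian. y \<in> Pair v -` Q \<longrightarrow> y \<in> - ball z \<delta>"
          using good
        proof eventually_elim
          case (elim y)
          then show ?case using z(2)[of y] by (force simp: Q_def)
        qed
      qed auto
      also have "\<dots> = ennreal (1 - G.prob (ball z \<delta>))"
        using G.prob_compl[of "ball z \<delta>"] by (simp add: G.emeasure_eq_measure Compl_eq_Diff_UNIV)
      also have "\<dots> \<le> ennreal (1 - p)"
      proof (rule ennreal_leI)
        have "q \<le> G.prob (ball z \<delta>)" using q(2)[OF z(1)] by (simp add: G.emeasure_eq_measure)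
        then show "1 - G.prob (ball z \<delta>) \<le> 1 - p" by (simp add: p_def)
      qed
      finally show ?thesis using True by simp
    next
      case False
      \<comment> \<open>The state is already above the level, and strict increase makes failure a
        null event; hence the factor \<open>indicator U v\<close>.\<close>
      have "AE y in std_gaussian. y \<notin> Pair v -` Q"
        using good
      proof eventually_elim
        case (elim y)
        have "r v < r (zo_step A B v y)"
          using zo_step_eq(4)[OF v1 elim] rayleigh_zo_step[OF v1 elim] by simp
        then show ?case using False by (simp add: Q_def U_def)
      qed
      then have "emeasure std_gaussian (Pair v -` Q) = 0"
        using Qv by (subst (asm) AE_iff_measurable[of "Pair v -` Q"]) auto
      then show ?thesis by simp
    qed
  qed
  have rec: "emeasure M {\<omega> \<in> space M. r (V (Suc k) \<omega>) \<le> c} \<le>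
      ennreal (1 - p) * emeasure M {\<omega> \<in> space M. r (V k \<omega>) \<le> c}" for k
  proof -
    have "AE v in distr M borel (V k). regular_state A B v"
      using AE_regular by (subst AE_distr_iff) auto
    then have "AE v in distr M borel (V k).
        emeasure (distr M borel (xt k)) (Pair v -` Q) \<le> ennreal (1 - p) * indicator U v"
      unfolding distr_std_gaussian[OF xt_normal] by eventually_elim (rule step)
    from emeasure_indep_var_pair_le[OF indep_state_sample Q U this]
    show ?thesis by (simp add: Q_def U_def V_Suc)
  qed
  have "emeasure M {\<omega> \<in> space M. r (V k \<omega>) \<le> c} \<le> ennreal ((1 - p) ^ k)" for k
  proof (induction k)
    case 0
    show ?case by (simp add: emeasure_le_1)
  next
    case (Suc k)
    have "emeasure M {\<omega> \<in> space M. r (V (Suc k) \<omega>) \<le> c} \<le> ennreal (1 - p) * ennreal ((1 - p) ^ k)"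
      using rec[of k] mult_left_mono[OF Suc, of "ennreal (1 - p)"] by (meson order_trans zero_le)
    then show ?case using p by (simp add: ennreal_mult')
  qed
  then show ?thesis using that p by blast
qed

text \<open>Never exceeding the level implies failure at every time \<open>k\<close>, and the
  failure probabilities tend to zero.\<close>

lemma AE_exceeds:
  assumes "c < \<rho>"
  shows "AE \<omega> in M. \<exists>k. c < r (V k \<omega>)"
proof -
  obtain p where p: "p > 0" "p \<le> 1"
    "\<And>k. emeasure M {\<omega> \<in> space M. r (V k \<omega>) \<le> c} \<le> ennreal ((1 - p) ^ k)"
    using failure_probability[OF assms] by blast
  define N where "N = {\<omega> \<in> space M. \<forall>k. r (V k \<omega>) \<le> c}"
  have N: "N \<in> sets M" unfolding N_def by measurable
  have "emeasure M N \<le> ennreal ((1 - p) ^ k)" for k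
  proof -
    have "emeasure M N \<le> emeasure M {\<omega> \<in> space M. r (V k \<omega>) \<le> c}"
      by (intro emeasure_mono) (auto simp: N_def)
    then show ?thesis using p(3)[of k] by simp
  qed
  then have "measure M N \<le> (1 - p) ^ k" for k
    using p by (simp add: emeasure_eq_measure)
  moreover have "(\<lambda>k. (1 - p) ^ k) \<longlonglongrightarrow> 0"
    using p by (intro LIMSEQ_realpow_zero) auto
  ultimately have "measure M N \<le> 0"
    by (intro LIMSEQ_le_const[of "\<lambda>k. (1 - p) ^ k"]) auto
  then have "measure M N = 0" by (simp add: measure_le_0_iff)
  then have "N \<in> null_sets M"
    using N by (auto simp: emeasure_eq_measure intro!: null_setsI)
  then show ?thesis
    by (rule AE_I') (auto simp: N_def not_less)
qed

lemma zo_iterate_eq_V: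
  assumes "\<And>k. regular_state A B (V k \<omega>)"
    and "\<And>k. search_dir B (V k \<omega>) (xt k \<omega>) \<bullet> (S *v V k \<omega>) \<noteq> 0"
  shows "zo_iterate A B (vt \<omega>) (\<lambda>j. xt j \<omega>) k = Some (V k \<omega>)"
proof (induction k)
  case (Suc k)
  note v = regular_stateD(1)[OF assms(1)[of k]]
  show ?case
    using assms(2)[of k] zo_step_eq(1,5)[OF v assms(2)[of k]]
    by (simp add: Suc V_Suc Let_def)
qed (simp add: V_0)

lemma zo_process_converges:
  "AE \<omega> in M. \<exists>v. (\<forall>k. zo_iterate A B (vt \<omega>) (\<lambda>j. xt j \<omega>) k = Some (v k)) \<and>
    (\<lambda>k. r (v k)) \<longlonglongrightarrow> \<rho> \<and> (\<lambda>k. infdist (v k) (G_max A B)) \<longlonglongrightarrow> 0"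
proof -
  \<comment> \<open>Countably many levels approach \<open>\<rho>\<close>, so their exceptional null
    sets can be united.\<close>
  have "AE \<omega> in M. \<forall>n. \<exists>k. \<rho> - 1 / real (Suc n) < r (V k \<omega>)"
    unfolding AE_all_countable by (intro allI AE_exceeds) simp
  then show ?thesis using AE_all_regular
  proof eventually_elim
    case (elim \<omega>)
    then have reg: "\<And>k. regular_state A B (V k \<omega>)"
      and b: "\<And>k. search_dir B (V k \<omega>) (xt k \<omega>) \<bullet> (S *v V k \<omega>) \<noteq> 0" by auto
    note v1 = regular_stateD(1)[OF reg] and v0 = regular_stateD(2)[OF reg]
    \<comment> \<open>Monotonicity turns exceeding a level once into exceeding it from then
      on.\<close>
    have "r (V k \<omega>) \<le> r (V (Suc k) \<omega>)" for k
      using zo_step_eq(4)[OF v1 b, of k] rayleigh_zo_step[OF v1 b, of k] by (simp add: V_Suc)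
    then have mono: "incseq (\<lambda>k. r (V k \<omega>))" by (rule incseq_SucI)
    have lim: "(\<lambda>k. r (V k \<omega>)) \<longlonglongrightarrow> \<rho>"
    proof (rule order_tendstoI)
      show "\<forall>\<^sub>F k in sequentially. r (V k \<omega>) < a" if "\<rho> < a" for a
        using order_le_less_trans[OF rayleigh_le_max[OF v0] that] by simp
      fix a assume "a < \<rho>"
      then obtain n where "1 / real (Suc n) < \<rho> - a"
        using nat_approx_posE[of "\<rho> - a"] by auto
      moreover obtain k where "\<rho> - 1 / real (Suc n) < r (V k \<omega>)" using elim by blast
      ultimately have "a < r (V k \<omega>)" by simp
      then have "a < r (V j \<omega>)" if "j \<ge> k" for j
        using incseqD[OF mono that] by simp
      then show "\<forall>\<^sub>F k in sequentially. a < r (V k \<omega>)"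
        by (auto simp: eventually_sequentially)
    qed
    show ?case
      using zo_iterate_eq_V[OF reg b] lim infdist_G_max_tendsto[OF v1 lim]
      by (intro exI[of _ "\<lambda>k. V k \<omega>"]) simp
  qed
qed

end

theorem theorem5p6:
  fixes A B :: "real^'n^'n"
    and M :: "'w measure"
    and vt :: "'w \<Rightarrow> real^'n"
    and xt :: "nat \<Rightarrow> 'w \<Rightarrow> real^'n"
  assumes B_sym: "transpose B = B"
    and B_pos: "\<And>x. x \<noteq> 0 \<Longrightarrow> 0 < x \<bullet> (B *v x)"
    and M: "prob_space M"
    and vt_normal: "distributed M lborel vt std_gaussian_density"
    and xt_normal: "\<And>k. distributed M lborel (xt k) std_gaussian_density"
    and indep: "prob_space.indep_vars M (\<lambda>_. borel)
      (\<lambda>i. case i of 0 \<Rightarrow> vt | Suc k \<Rightarrow> xt k) UNIV"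
    and dim_G_max: "dim (G_max A B \<union> {0}) < CARD('n) - 1"
  shows "AE \<omega> in M. \<exists>v. (\<forall>k. zo_iterate A B (vt \<omega>) (\<lambda>j. xt j \<omega>) k = Some (v k)) \<and>
    (\<lambda>k. rayleigh A B (v k)) \<longlonglongrightarrow> rayleigh_max A B \<and>
    (\<lambda>k. infdist (v k) (G_max A B)) \<longlonglongrightarrow> 0"
proof -
  interpret prob_space M by (rule M)
  interpret zo_process A B M vt xt
    by unfold_locales (fact B_sym B_pos vt_normal xt_normal indep dim_G_max)+
  show ?thesis by (rule zo_process_converges)
qed

end
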